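(* Let $d\ge1$, let $\mathcal{K}_{\ell_\infty}\subset\mathbb{R}\times\mathbb{R}^d$ be the infinity norm cone with barrier $f$, and let $g^\ast$ be its conjugate gradient (all defined in the context). For every $(p,r)\in\operatorname{int}(\mathcal{K}_{\ell_\infty}^\ast)$, the components of $g^\ast=g^\ast(p,r)$ are $$g^\ast_p=\hat y,\qquad g^\ast_{r_i}=\begin{cases}\dfrac{\sqrt{1+\hat y^2r_i^2}-1}{r_i}&r_i\ne0\\0&r_i=0\end{cases}\quad(i=1,\dots,d),$$ where $\hat y$ is the unique negative root of $h(y)=py+\sum_{i=1}^d\sqrt{1+r_i^2y^2}+1$.
   Context: For a closed, convex, pointed, full-dimensional cone $\mathcal{K}$ in a finite-dimensional real inner product space, the dual cone is $\mathcal{K}^\ast=\{s:\langle w,s\rangle\ge 0\ \forall w\in\mathcal{K}\}$. Given a barrier function $f:\operatorname{int}(\mathcal{K})\to\mathbb{R}$, the conjugate barrier is $f^\ast(s)=\sup_{w\in\operatorname{int}(\mathcal{K})}\{-\langle s,w\rangle-f(w)\}$ for $s\in\operatorname{int}(\mathcal{K}^\ast)$, and the conjugate gradient $g^\ast$ is the gradient of $f^\ast$; equivalently $g^\ast(s)=-\operatorname{argsup}_{w\in\operatorname{int}(\mathcal{K})}\{-\langle s,w\rangle-f(w)\}$. The standard inner product is used. The infinity norm cone is $\mathcal{K}_{\ell_\infty}=\{(u,w)\in\mathbb{R}\times\mathbb{R}^d:u\ge\|w\|_\infty\}$ with barrier $f(u,w)=-\sum_{i=1}^d\log(u^2-w_i^2)+(d-1)\log(u)$.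 Its dual cone is $\mathcal{K}_{\ell_\infty}^\ast=\{(p,r)\in\mathbb{R}\times\mathbb{R}^d:p\ge\|r\|_1\}$. Subscripts $p,r_i$ on $g^\ast$ denote the corresponding components. *)

theory Defs
  imports "HOL-Analysis.Analysis"
begin

definition dual_cone :: "'a::real_inner set \<Rightarrow> 'a set" where
  "dual_cone K = {s. \<forall>w\<in>K. inner w s \<ge> 0}"

text \<open>The supremum is taken in \<^typ>\<open>real\<close>, so it is meaningful only where the image set is
  bounded above. The same caveat applies to the gradient, which is meaningful only where the
  conjugate barrier is differentiable.\<close>

definition conjugate_barrier :: "'a::real_inner set \<Rightarrow> ('a \<Rightarrow> real) \<Rightarrow> 'a \<Rightarrow> real" where
  "conjugate_barrier K f s = (SUP w\<in>interior K. - inner s w - f w)"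

definition conjugate_gradient :: "'a::real_inner set \<Rightarrow> ('a \<Rightarrow> real) \<Rightarrow> 'a \<Rightarrow> 'a" where
  "conjugate_gradient K f s = (THE g. GDERIV (conjugate_barrier K f) s :> g)"

definition linf_cone :: "(real \<times> (real ^ 'd)) set" where
  "linf_cone = {(u, w). u \<ge> infnorm w}"

definition linf_barrier :: "real \<times> (real ^ 'd) \<Rightarrow> real" where
  "linf_barrier = (\<lambda>(u, w). - (\<Sum>i\<in>UNIV. ln (u\<^sup>2 - (w $ i)\<^sup>2)) + (real CARD('d) - 1) * ln u)"

definition linf_root_fun :: "real \<Rightarrow> real ^ 'd \<Rightarrow> real \<Rightarrow> real" where
  "linf_root_fun p r y = p * y + (\<Sum>i\<in>UNIV. sqrt (1 + (r $ i)\<^sup>2 * y\<^sup>2)) + 1"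

lemma infnorm_cart_le_iff:
  fixes w :: "real ^ 'd"
  shows "infnorm w \<le> u \<longleftrightarrow> (\<forall>i. \<bar>w $ i\<bar> \<le> u)"
proof
  assume "infnorm w \<le> u"
  then show "\<forall>i. \<bar>w $ i\<bar> \<le> u"
    using component_le_infnorm_cart order_trans by blast
next
  assume "\<forall>i. \<bar>w $ i\<bar> \<le> u"
  then show "infnorm w \<le> u"
    unfolding infnorm_cart by (intro cSup_least) auto
qed

lemma dual_cone_linf_cone:
  "dual_cone linf_cone = {(p, r :: real ^ 'd). p \<ge> (\<Sum>i\<in>UNIV. \<bar>r $ i\<bar>)}"
proof (intro set_eqI iffI; clarify)
  fix p and r :: "real ^ 'd"
  assume dual: "(p, r) \<in> dual_cone linf_cone"
  have "(1, \<chi> i. - sgn (r $ i)) \<in> linf_cone"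
    by (simp add: linf_cone_def infnorm_cart_le_iff abs_sgn_eq)
  with dual have "0 \<le> p - (\<Sum>i\<in>UNIV. sgn (r $ i) * r $ i)"
    by (fastforce simp: dual_cone_def inner_vec_def sum_negf)
  then show "(\<Sum>i\<in>UNIV. \<bar>r $ i\<bar>) \<le> p"
    by (simp add: abs_sgn mult.commute)
next
  fix p and r :: "real ^ 'd"
  assume le: "(\<Sum>i\<in>UNIV. \<bar>r $ i\<bar>) \<le> p"
  have "0 \<le> u * p + inner w r" if w: "infnorm w \<le> u" for u and w :: "real ^ 'd"
  proof -
    have u: "0 \<le> u" using w infnorm_pos_le[of w] by linarith
    have "- inner w r = (\<Sum>i\<in>UNIV. - (w $ i * r $ i))"
      by (simp add: inner_vec_def sum_negf)
    also have "\<dots> \<le> (\<Sum>i\<in>UNIV. u * \<bar>r $ i\<bar>)"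
    proof (rule sum_mono)
      fix i
      have "- (w $ i * r $ i) \<le> \<bar>w $ i\<bar> * \<bar>r $ i\<bar>"
        by (metis abs_ge_minus_self abs_mult)
      also have "\<dots> \<le> u * \<bar>r $ i\<bar>"
        using w by (intro mult_right_mono) (auto simp: infnorm_cart_le_iff)
      finally show "- (w $ i * r $ i) \<le> u * \<bar>r $ i\<bar>" .
    qed
    also have "\<dots> \<le> u * p"
      using le u by (simp add: sum_distrib_left[symmetric] mult_left_mono)
    finally show ?thesis by linarith
  qed
  then show "(p, r) \<in> dual_cone linf_cone"
    by (auto simp: dual_cone_def linf_cone_def)
qed

end

theory Submission imports Defs begin

text \<open>
  The conjugate barrier is a supremum of functions that are affine in \<open>s\<close>. If the supremum is attained at
  a point \<open>m s\<close>, then \<open>- m s\<close> is a subgradient, and if moreover \<open>m\<close> is continuous, the subgradient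
  inequalities at \<open>s\<close> and at nearby points squeeze the difference quotient, so that \<open>- m s\<close> is the
  gradient (\<open>GDERIV_conjugate_barrier\<close>). It remains to find the maximiser explicitly and to see that
  it is continuous.

  For fixed \<open>u\<close> the objective \<open>- p u - \<langle>r, w\<rangle> - f(u, w)\<close> splits into one problem
  per coordinate, namely to maximise \<open>- r\<^sub>i w\<^sub>i + ln (u\<^sup>2 - w\<^sub>i\<^sup>2)\<close>. The solution is
  \<open>w\<^sub>i = - r\<^sub>i u\<^sup>2 / (1 + S\<^sub>i)\<close> with \<open>S\<^sub>i = sqrt (1 + r\<^sub>i\<^sup>2 u\<^sup>2)\<close>
  (\<open>log_quadratic_le\<close> and \<open>log_quadratic_eq\<close>). What is left is a function of \<open>u\<close> alone,
  whose derivative (\<open>DERIV_linf_radial\<close>) is \<open>h(- u) / u\<close>. In the variable \<open>x = 1 / u\<close> this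
  derivative is \<open>(\<Sum>i. sqrt (x\<^sup>2 + r\<^sub>i\<^sup>2)) + x - p\<close>, which is visibly strictly increasing on
  \<open>x \<ge> 0\<close> and negative at \<open>0\<close> because \<open>p > \<parallel>r\<parallel>\<^sub>1\<close>. Hence it has exactly one
  positive zero, the reduced problem is maximal there, and the zero depends continuously on \<open>(p, r)\<close>.
  The negative root of \<open>h\<close> is \<open>y = - u = - 1 / x\<close>, and the gradient is minus the maximiser.
\<close>

section \<open>The gradient of a conjugate barrier\<close>

lemma conjugate_barrier_eq_at_maximizer:
  assumes "m \<in> interior K"
    and "\<And>w. w \<in> interior K \<Longrightarrow> - inner s w - f w \<le> - inner s m - f m"
  shows "conjugate_barrier K f s = - inner s m - f m"
  unfolding conjugate_barrier_def using assms by (intro cSup_eq_maximum) auto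

text \<open>
  Comparing the maximum at \<open>t\<close> with the objective value at the maximiser for \<open>s\<close>, and vice versa, traps
  the linearisation error between \<open>0\<close> and \<open>- inner (t - s) (m t - m s)\<close>. By Cauchy-Schwarz and the
  continuity of \<open>m\<close> this is \<open>o(norm (t - s))\<close>.
\<close>

lemma GDERIV_conjugate_barrier:
  fixes m :: "'a::real_inner \<Rightarrow> 'a"
  assumes "open U" "s \<in> U"
    and mem: "\<And>t. t \<in> U \<Longrightarrow> m t \<in> interior K"
    and max: "\<And>t w. t \<in> U \<Longrightarrow> w \<in> interior K \<Longrightarrow>
                - inner t w - f w \<le> - inner t (m t) - f (m t)"
    and cont: "isCont m s"
  shows "GDERIV (conjugate_barrier K f) s :> - m s"
proof -
  let ?F = "conjugate_barrier K f"
  have F: "?F t = - inner t (m t) - f (m t)" if "t \<in> U" for t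
    by (rule conjugate_barrier_eq_at_maximizer[OF mem[OF that] max[OF that]])
  \<comment> \<open>At \<open>t = s\<close> the quotient is \<open>0\<close> by the convention for division by zero.\<close>
  have sub: "norm (?F t - ?F s - inner (t - s) (- m s)) / norm (t - s) \<le> norm (m t - m s)"
    if t: "t \<in> U" for t
  proof -
    have lo: "?F t \<ge> - inner t (m s) - f (m s)"
      using F[OF t] max[OF t mem[OF \<open>s \<in> U\<close>]] by simp
    have hi: "?F s \<ge> - inner s (m t) - f (m t)"
      using F[OF \<open>s \<in> U\<close>] max[OF \<open>s \<in> U\<close> mem[OF t]] by simp
    have "norm (?F t - ?F s - inner (t - s) (- m s)) \<le> - inner (t - s) (m t - m s)"
      using lo hi F[OF t] F[OF \<open>s \<in> U\<close>]
      by (simp only: inner_diff_left inner_diff_right inner_minus_right real_norm_def abs_le_iff) linarith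
    also have "\<dots> \<le> norm (t - s) * norm (m t - m s)"
      using Cauchy_Schwarz_ineq2[of "t - s" "m t - m s"] by linarith
    finally have le: "norm (?F t - ?F s - inner (t - s) (- m s)) \<le> norm (m t - m s) * norm (t - s)"
      by (simp only: mult.commute)
    show ?thesis
    proof (cases "t = s")
      case False
      then show ?thesis using le by (subst pos_divide_le_eq) simp_all
    qed simp
  qed
  have lim: "((\<lambda>t. norm (m t - m s)) \<longlongrightarrow> 0) (at s)"
    using cont by (simp add: isCont_def LIM_zero tendsto_norm_zero)
  have "\<forall>\<^sub>F t in at s. t \<in> U"
    using assms(1,2) by (rule eventually_at_in_open')
  then have upper: "\<forall>\<^sub>F t in at s.
      norm (?F t - ?F s - inner (t - s) (- m s)) / norm (t - s) \<le> norm (m t - m s)"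
    by (rule eventually_mono) (rule sub)
  have lower: "\<forall>\<^sub>F t in at s. 0 \<le> norm (?F t - ?F s - inner (t - s) (- m s)) / norm (t - s)"
    by (intro always_eventually allI divide_nonneg_nonneg norm_ge_zero)
  have "((\<lambda>t. norm (?F t - ?F s - inner (t - s) (- m s)) / norm (t - s)) \<longlongrightarrow> 0) (at s)"
    using lower upper tendsto_const lim by (rule real_tendsto_sandwich)
  then show ?thesis
    unfolding gderiv_def has_derivative_iff_norm
    by (intro conjI bounded_linear_inner_left)
qed

lemma GDERIV_unique:
  assumes "GDERIV f s :> a" "GDERIV f s :> b"
  shows "a = b"
proof -
  have "(\<lambda>h. inner h a) = (\<lambda>h. inner h b)"
    using assms unfolding gderiv_def by (rule has_derivative_unique)
  then show ?thesis
    unfolding fun_eq_iff vector_eq_ldot .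
qed

lemma conjugate_gradient_eqI:
  assumes "GDERIV (conjugate_barrier K f) s :> g"
  shows "conjugate_gradient K f s = g"
  unfolding conjugate_gradient_def using assms
  by (rule the_equality) (rule GDERIV_unique[OF _ assms])

section \<open>Interiors of the cones\<close>

text \<open>
  Both cones constrain the first coordinate from below, so the strict inequality at an interior point
  comes from lowering that coordinate a little.
\<close>

lemma interior_shift_fst:
  fixes a :: real and b :: "'b::real_normed_vector"
  assumes "(a, b) \<in> interior A"
  obtains e where "e > 0" "(a - e, b) \<in> A"
proof -
  obtain e where e: "e > 0" "ball (a, b) e \<subseteq> A"
    using assms by (auto simp: mem_interior)
  have "(a - e / 2, b) \<in> ball (a, b) e"
    using e by (simp add: dist_prod_def dist_real_def)
  then show thesis using that[of "e / 2"] e by auto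
qed

lemma mem_interior_dual_linf_coneD:
  fixes r :: "real ^ 'd"
  assumes "(p, r) \<in> interior (dual_cone linf_cone)"
  shows "(\<Sum>i\<in>UNIV. \<bar>r $ i\<bar>) < p"
  using interior_shift_fst[OF assms] by (force simp: dual_cone_linf_cone)

lemma interior_linf_cone:
  "interior linf_cone = {(u, w :: real ^ 'd). \<forall>i. \<bar>w $ i\<bar> < u}" (is "_ = ?S")
proof
  show "interior linf_cone \<subseteq> ?S"
  proof clarify
    fix u i and w :: "real ^ 'd"
    assume "(u, w) \<in> interior linf_cone"
    then obtain e where "e > 0" "(u - e, w) \<in> linf_cone"
      by (rule interior_shift_fst)
    then show "\<bar>w $ i\<bar> < u"
      by (auto simp: linf_cone_def infnorm_cart_le_iff dest!: spec[of _ i])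
  qed
next
  have "?S = (\<Inter>i. {z. \<bar>snd z $ i\<bar> < fst z})" by auto
  moreover have "open \<dots>"
    by (intro open_INT finite ballI open_Collect_less continuous_intros)
  ultimately have "open ?S" by (simp only:)
  moreover have "?S \<subseteq> linf_cone"
    by (auto simp: linf_cone_def infnorm_cart_le_iff less_imp_le)
  ultimately show "?S \<subseteq> interior linf_cone" by (intro interior_maximal)
qed

section \<open>Eliminating the inner variables\<close>

text \<open>
  The bound is the tangent inequality \<open>ln a \<le> ln b + (a - b) / b\<close> at the optimal value
  \<open>b = 2 u\<^sup>2 / (1 + S)\<close> of \<open>u\<^sup>2 - w\<^sup>2\<close>. It leaves a concave quadratic in \<open>w\<close>, and completing
  the square shows that its maximum is the claimed constant.
\<close>

lemma log_quadratic_le: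
  fixes u w r :: real
  assumes "\<bar>w\<bar> < u"
  defines "S \<equiv> sqrt (1 + r\<^sup>2 * u\<^sup>2)"
  shows "- (r * w) + ln (u\<^sup>2 - w\<^sup>2) \<le> S - 1 + ln (2 * u\<^sup>2 / (1 + S))"
proof -
  have u: "u > 0" and pos: "u\<^sup>2 - w\<^sup>2 > 0"
    using assms(1) abs_less_iff by (linarith, simp add: power2_strict_mono)
  have S: "S \<ge> 1" and S2: "S\<^sup>2 = 1 + r\<^sup>2 * u\<^sup>2" by (simp_all add: S_def)
  let ?b = "2 * u\<^sup>2 / (1 + S)"
  have b: "?b > 0" using u S by simp
  have "ln (u\<^sup>2 - w\<^sup>2) - ln ?b \<le> (u\<^sup>2 - w\<^sup>2) / ?b - 1"
    using ln_diff_le[OF pos b] b by (metis diff_divide_distrib divide_self less_irrefl)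
  moreover have "(u\<^sup>2 - w\<^sup>2) / ?b - 1 - r * w - (S - 1) = - (w * (1 + S) + r * u\<^sup>2)\<^sup>2 / (2 * u\<^sup>2 * (1 + S))"
  proof -
    have sq: "(w * (1 + S) + r * u\<^sup>2)\<^sup>2 = (1 + S) * (w\<^sup>2 * (1 + S) + 2 * w * r * u\<^sup>2 + (S - 1) * u\<^sup>2)"
      using S2 by algebra
    have "1 + S \<noteq> 0" using S by simp
    then show ?thesis using u unfolding sq by (simp add: divide_simps) algebra
  qed
  moreover have "\<dots> \<le> 0" using S by simp
  ultimately show ?thesis by linarith
qed

text \<open>
  The maximiser is the root of the stationarity condition \<open>r w\<^sup>2 - 2 w - r u\<^sup>2 = 0\<close> with
  \<open>\<bar>w\<bar> < u\<close>. Its usual form \<open>(1 - S) / r\<close> is rationalised here, so that it is also correct, and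
  continuous, at \<open>r = 0\<close>.
\<close>

lemma log_quadratic_eq:
  fixes u r :: real
  assumes "u > 0"
  defines "S \<equiv> sqrt (1 + r\<^sup>2 * u\<^sup>2)"
  defines "w \<equiv> - (r * u\<^sup>2 / (1 + S))"
  shows "\<bar>w\<bar> < u" and "- (r * w) + ln (u\<^sup>2 - w\<^sup>2) = S - 1 + ln (2 * u\<^sup>2 / (1 + S))"
proof -
  have S: "S \<ge> 1" and S2: "S\<^sup>2 = 1 + r\<^sup>2 * u\<^sup>2" by (simp_all add: S_def)
  have nz: "1 + S \<noteq> 0" using S by simp
  have 1: "u\<^sup>2 - w\<^sup>2 = 2 * u\<^sup>2 / (1 + S)"
    using nz S2 unfolding w_def by (simp add: field_simps) algebra
  have "2 * u\<^sup>2 / (1 + S) > 0" using S assms(1) by simp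
  then have "\<bar>w\<bar>\<^sup>2 < u\<^sup>2" using 1 by simp
  then show "\<bar>w\<bar> < u" using assms(1) power_less_imp_less_base by (metis less_imp_le)
  have "- (r * w) = S - 1"
    using nz S2 unfolding w_def by (simp add: field_simps) algebra
  with 1 show "- (r * w) + ln (u\<^sup>2 - w\<^sup>2) = S - 1 + ln (2 * u\<^sup>2 / (1 + S))" by simp
qed

text \<open>The maximum of the objective over \<open>w\<close> for fixed \<open>u\<close>.\<close>

definition linf_radial :: "real \<Rightarrow> real ^ 'd \<Rightarrow> real \<Rightarrow> real" where
  "linf_radial p r u = - p * u
     + (\<Sum>i\<in>UNIV. sqrt (1 + (r $ i)\<^sup>2 * u\<^sup>2) - 1 + ln (2 * u\<^sup>2 / (1 + sqrt (1 + (r $ i)\<^sup>2 * u\<^sup>2))))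
     - (real CARD('d) - 1) * ln u"

definition linf_inner_opt :: "real ^ 'd \<Rightarrow> real \<Rightarrow> real ^ 'd" where
  "linf_inner_opt r u = (\<chi> i. - (r $ i * u\<^sup>2 / (1 + sqrt (1 + (r $ i)\<^sup>2 * u\<^sup>2))))"

lemma linf_objective_eq:
  fixes r w :: "real ^ 'd"
  shows "- inner (p, r) (u, w) - linf_barrier (u, w) =
    - p * u + (\<Sum>i\<in>UNIV. - (r $ i * w $ i) + ln (u\<^sup>2 - (w $ i)\<^sup>2)) - (real CARD('d) - 1) * ln u"
  by (simp add: linf_barrier_def inner_vec_def sum_subtractf)

lemma linf_objective_le_radial:
  assumes "(u, w) \<in> interior linf_cone"
  shows "- inner (p, r) (u, w) - linf_barrier (u, w) \<le> linf_radial p r u"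
  unfolding linf_objective_eq linf_radial_def
  using assms by (intro diff_right_mono add_left_mono sum_mono log_quadratic_le)
    (simp add: interior_linf_cone)

lemma linf_inner_opt:
  assumes "u > 0"
  shows "(u, linf_inner_opt r u) \<in> interior linf_cone"
    and "- inner (p, r) (u, linf_inner_opt r u) - linf_barrier (u, linf_inner_opt r u) = linf_radial p r u"
  unfolding linf_objective_eq linf_radial_def
  using log_quadratic_eq[OF assms] by (auto simp: interior_linf_cone linf_inner_opt_def)

section \<open>The radial problem\<close>

text \<open>
  The derivative of \<^const>\<open>linf_radial\<close>, written in the variable \<open>x = 1 / u\<close>, in which its monotonicity
  is evident and its value at \<open>0\<close>, the limit \<open>u \<rightarrow> \<infinity>\<close>, makes sense.
\<close>

definition linf_slope :: "real \<Rightarrow> real ^ 'd \<Rightarrow> real \<Rightarrow> real" where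
  "linf_slope p r x = (\<Sum>i\<in>UNIV. sqrt (x\<^sup>2 + (r $ i)\<^sup>2)) + x - p"

lemma linf_slope_strict_mono:
  assumes "0 \<le> x" "x < x'"
  shows "linf_slope p r x < linf_slope p r x'"
proof -
  have "(\<Sum>i\<in>UNIV. sqrt (x\<^sup>2 + (r $ i)\<^sup>2)) \<le> (\<Sum>i\<in>UNIV. sqrt (x'\<^sup>2 + (r $ i)\<^sup>2))"
    using assms by (intro sum_mono) (simp add: power_mono)
  with assms show ?thesis by (simp add: linf_slope_def)
qed

lemma sqrt_rescale:
  fixes a u :: real
  assumes "u > 0"
  shows "sqrt ((1 / u)\<^sup>2 + a\<^sup>2) = sqrt (1 + a\<^sup>2 * u\<^sup>2) / u"
proof -
  have "(1 / u)\<^sup>2 + a\<^sup>2 = (1 + a\<^sup>2 * u\<^sup>2) / u\<^sup>2"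
    using assms by (simp add: field_simps)
  then show ?thesis using assms by (simp add: real_sqrt_divide)
qed

lemma linf_root_fun_eq_slope:
  assumes "u > 0"
  shows "linf_root_fun p r (- u) = u * linf_slope p r (1 / u)"
  using assms unfolding linf_root_fun_def linf_slope_def sqrt_rescale[OF assms]
  by (simp add: sum_divide_distrib[symmetric] distrib_left right_diff_distrib mult.commute)

text \<open>
  Each summand of \<^const>\<open>linf_radial\<close> equals \<open>S - ln (1 + S) + 2 ln u\<close> up to a constant. Since
  \<open>S' = a\<^sup>2 u / S\<close>, the derivative of \<open>S - ln (1 + S)\<close> is \<open>a\<^sup>2 u / (1 + S) = (S - 1) / u\<close>. With the
  \<open>2 / u\<close> of the logarithm this gives \<open>S / u + 1 / u\<close>. Of the \<open>d\<close> terms \<open>1 / u\<close> the barrier term \<open>(d - 1) ln u\<close>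
  cancels all but one.
\<close>

lemma DERIV_linf_radial:
  fixes r :: "real ^ 'd"
  assumes "u > 0"
  shows "(linf_radial p r has_real_derivative linf_slope p r (1 / u)) (at u)"
proof -
  have 1: "((\<lambda>u. sqrt (1 + a\<^sup>2 * u\<^sup>2) - 1 + ln (2 * u\<^sup>2 / (1 + sqrt (1 + a\<^sup>2 * u\<^sup>2))))
      has_real_derivative sqrt ((1 / u)\<^sup>2 + a\<^sup>2) + 1 / u) (at u)" for a :: real
  proof -
    define f where "f = (\<lambda>u. sqrt (1 + a\<^sup>2 * u\<^sup>2))"
    define S where "S = f u"
    have S: "S \<ge> 1" and S2: "S\<^sup>2 = 1 + a\<^sup>2 * u\<^sup>2" by (simp_all add: S_def f_def)
    have nz: "1 + S \<noteq> 0" "S \<noteq> 0" using S by auto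
    have "1 + a\<^sup>2 * u\<^sup>2 > 0" by (simp add: add_pos_nonneg)
    then have df: "(f has_real_derivative a\<^sup>2 * u / S) (at u)"
      unfolding S_def f_def by (auto intro!: derivative_eq_intros simp: field_simps)
    have "2 * u\<^sup>2 / (1 + f u) > 0" using assms S by (simp add: S_def)
    then have "((\<lambda>u. f u - 1 + ln (2 * u\<^sup>2 / (1 + f u)))
      has_real_derivative a\<^sup>2 * u / S + (4 * u * (1 + S) - 2 * u\<^sup>2 * (a\<^sup>2 * u / S)) / (1 + S)\<^sup>2 / (2 * u\<^sup>2 / (1 + S))) (at u)"
      using nz by (auto intro!: derivative_eq_intros df simp: S_def power2_eq_square)
    moreover have "a\<^sup>2 * u / S + (4 * u * (1 + S) - 2 * u\<^sup>2 * (a\<^sup>2 * u / S)) / (1 + S)\<^sup>2 / (2 * u\<^sup>2 / (1 + S))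
        = sqrt ((1 / u)\<^sup>2 + a\<^sup>2) + 1 / u"
    proof -
      have fS: "sqrt ((1 / u)\<^sup>2 + a\<^sup>2) = S / u"
        unfolding sqrt_rescale[OF assms] by (simp add: S_def f_def)
      have a2: "a\<^sup>2 = (S\<^sup>2 - 1) / u\<^sup>2" using S2 assms by simp
      show ?thesis
        unfolding fS unfolding a2 using assms nz
        by (simp add: divide_simps) algebra
    qed
    ultimately show ?thesis by (simp add: f_def)
  qed
  have "((\<lambda>u. linf_radial p r u) has_real_derivative
      - p + (\<Sum>i\<in>UNIV. sqrt ((1 / u)\<^sup>2 + (r $ i)\<^sup>2) + 1 / u) - (real CARD('d) - 1) * (1 / u)) (at u)"
    unfolding linf_radial_def using assms
    by (intro 1 DERIV_diff DERIV_add DERIV_sum DERIV_cmult_Id DERIV_cmult DERIV_ln_divide)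
  then show ?thesis by (simp add: linf_slope_def sum.distrib algebra_simps)
qed

text \<open>The slope decreases in \<open>u\<close>, so the radial function rises up to its critical point and falls after it.\<close>

lemma linf_radial_le:
  assumes "u > 0" "v > 0" "linf_slope p r (1 / u) = 0"
  shows "linf_radial p r v \<le> linf_radial p r u"
proof (cases "v \<le> u")
  case True
  show ?thesis
  proof (rule DERIV_nonneg_imp_nondecreasing[OF True])
    fix t assume t: "v \<le> t" "t \<le> u"
    then have "linf_slope p r (1 / t) \<ge> linf_slope p r (1 / u)"
      using assms linf_slope_strict_mono[of "1 / u" "1 / t" p r]
      by (cases "t = u") (auto simp: frac_less2 less_imp_le)
    then show "\<exists>y. (linf_radial p r has_real_derivative y) (at t) \<and> 0 \<le> y"
      using DERIV_linf_radial[of t p r] assms t by auto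
  qed
next
  case False
  then have "u \<le> v" by simp
  then show ?thesis
  proof (rule DERIV_nonpos_imp_nonincreasing)
    fix t assume t: "u \<le> t" "t \<le> v"
    then have "linf_slope p r (1 / t) \<le> linf_slope p r (1 / u)"
      using assms linf_slope_strict_mono[of "1 / t" "1 / u" p r]
      by (cases "t = u") (auto simp: frac_less2 less_imp_le)
    then show "\<exists>y. (linf_radial p r has_real_derivative y) (at t) \<and> y \<le> 0"
      using DERIV_linf_radial[of t p r] assms t by auto
  qed
qed

section \<open>The critical point and the maximiser as functions of the dual variable\<close>

lemma linf_slope_root_ex1:
  assumes "(\<Sum>i\<in>UNIV. \<bar>r $ i\<bar>) < p"
  shows "\<exists>!x. 0 < x \<and> linf_slope p r x = 0"
proof (rule ex_ex1I)
  have p: "p > 0" using assms by (rule le_less_trans[rotated]) (simp add: sum_nonneg)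
  have lo: "linf_slope p r 0 < 0" using assms by (simp add: linf_slope_def)
  \<comment> \<open>At \<open>x = p\<close> the terms \<open>x - p\<close> cancel and only a sum of square roots remains.\<close>
  have hi: "linf_slope p r p \<ge> 0" by (simp add: linf_slope_def sum_nonneg)
  have "\<exists>x\<ge>0. x \<le> p \<and> linf_slope p r x = 0"
    using lo hi p unfolding linf_slope_def by (intro IVT') (auto intro!: continuous_intros)
  then show "\<exists>x>0. linf_slope p r x = 0"
    using lo by (metis less_le)
next
  fix x x' assume "0 < x \<and> linf_slope p r x = 0" "0 < x' \<and> linf_slope p r x' = 0"
  then show "x = x'"
    using linf_slope_strict_mono[of x x' p r] linf_slope_strict_mono[of x' x p r]
    by (cases x x' rule: linorder_cases) auto
qed

text \<open>The value \<open>x = - 1 / y\<close>, where \<open>y\<close> is the negative root of \<^const>\<open>linf_root_fun\<close>.\<close>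

definition linf_slope_root :: "real \<times> (real ^ 'd) \<Rightarrow> real" where
  "linf_slope_root s = (THE x. 0 < x \<and> linf_slope (fst s) (snd s) x = 0)"

lemma linf_slope_root:
  assumes "s \<in> interior (dual_cone linf_cone)"
  shows "linf_slope_root s > 0" "linf_slope (fst s) (snd s) (linf_slope_root s) = 0"
proof -
  have "(\<Sum>i\<in>UNIV. \<bar>snd s $ i\<bar>) < fst s"
    using assms by (intro mem_interior_dual_linf_coneD) simp
  from theI'[OF linf_slope_root_ex1[OF this]]
  show "linf_slope_root s > 0" "linf_slope (fst s) (snd s) (linf_slope_root s) = 0"
    unfolding linf_slope_root_def by auto
qed

lemma isCont_linf_slope:
  "isCont (\<lambda>s. linf_slope (fst s) (snd s) x) s"
  unfolding linf_slope_def isCont_def by (intro tendsto_intros)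

text \<open>
  For fixed \<open>x\<close> the slope is continuous in \<open>(p, r)\<close>, so its sign at a point \<open>a\<close> next to the root persists
  under small perturbations. As the slope is increasing in \<open>x\<close>, its sign at \<open>a\<close> tells on which side of
  \<open>a\<close> the perturbed root lies.
\<close>

lemma isCont_linf_slope_root:
  assumes s: "s \<in> interior (dual_cone linf_cone)"
  shows "isCont linf_slope_root s"
proof -
  let ?k = "\<lambda>t. linf_slope (fst t) (snd t)"
  have ev: "\<forall>\<^sub>F t in at s. t \<in> interior (dual_cone linf_cone)"
    using s by (intro eventually_at_in_open') auto
  show ?thesis
    unfolding isCont_def
  proof (rule order_tendstoI)
    fix a assume a: "a < linf_slope_root s"
    show "\<forall>\<^sub>F t in at s. a < linf_slope_root t"
    proof (cases "a \<le> 0")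
      case True
      show ?thesis using ev
        by eventually_elim (use linf_slope_root True in \<open>force\<close>)
    next
      case False
      then have "?k s a < 0"
        using linf_slope_strict_mono[of a "linf_slope_root s" "fst s" "snd s"] linf_slope_root(2)[OF s] a by simp
      then have "\<forall>\<^sub>F t in at s. ?k t a < 0"
        using isCont_linf_slope[of s a] by (intro order_tendstoD(2)) (auto simp: isCont_def)
      then show ?thesis using ev
      proof eventually_elim
        case (elim t)
        then show ?case
          using linf_slope_root[OF elim(2)] linf_slope_strict_mono[of "linf_slope_root t" a "fst t" "snd t"]
          by (cases a "linf_slope_root t" rule: linorder_cases) auto
      qed
    qed
  next
    fix a assume a: "linf_slope_root s < a"
    then have "?k s a > 0"
      using linf_slope_strict_mono[of "linf_slope_root s" a "fst s" "snd s"] linf_slope_root[OF s] by simp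
    then have "\<forall>\<^sub>F t in at s. ?k t a > 0"
      using isCont_linf_slope[of s a] by (intro order_tendstoD(1)) (auto simp: isCont_def)
    then show "\<forall>\<^sub>F t in at s. linf_slope_root t < a" using ev
    proof eventually_elim
      case (elim t)
      have "a > 0" using a linf_slope_root(1)[OF s] by simp
      then show ?case
        using elim linf_slope_root[OF elim(2)] linf_slope_strict_mono[of a "linf_slope_root t" "fst t" "snd t"]
        by (cases a "linf_slope_root t" rule: linorder_cases) auto
    qed
  qed
qed

definition linf_maximizer :: "real \<times> (real ^ 'd) \<Rightarrow> real \<times> (real ^ 'd)" where
  "linf_maximizer s = (1 / linf_slope_root s, linf_inner_opt (snd s) (1 / linf_slope_root s))"

lemma linf_maximizer:
  assumes "s \<in> interior (dual_cone linf_cone)"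
  shows "linf_maximizer s \<in> interior linf_cone"
    and "w \<in> interior linf_cone \<Longrightarrow>
      - inner s w - linf_barrier w \<le> - inner s (linf_maximizer s) - linf_barrier (linf_maximizer s)"
proof -
  obtain p r where s: "s = (p, r)" by fastforce
  have u: "1 / linf_slope_root s > 0" using linf_slope_root(1)[OF assms] by simp
  show "linf_maximizer s \<in> interior linf_cone"
    unfolding linf_maximizer_def using u by (rule linf_inner_opt)
  assume w: "w \<in> interior linf_cone"
  obtain v x where wv: "w = (v, x)" by fastforce
  \<comment> \<open>The index type is nonempty, so some \<open>\<bar>x $ i\<bar> < v\<close> forces \<open>v\<close> to be positive.\<close>
  have v: "v > 0" using w abs_ge_zero[of "x $ undefined"]
    unfolding wv interior_linf_cone by (auto dest!: spec[of _ undefined])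
  have "- inner s w - linf_barrier w \<le> linf_radial p r v"
    using w unfolding wv s by (rule linf_objective_le_radial)
  also have "\<dots> \<le> linf_radial p r (1 / linf_slope_root s)"
    using linf_radial_le[OF u v] linf_slope_root(2)[OF assms] s by simp
  also have "\<dots> = - inner s (linf_maximizer s) - linf_barrier (linf_maximizer s)"
    using linf_inner_opt(2)[OF u, of p r] unfolding linf_maximizer_def s by simp
  finally show "- inner s w - linf_barrier w \<le> - inner s (linf_maximizer s) - linf_barrier (linf_maximizer s)" .
qed

lemma isCont_linf_maximizer:
  assumes s: "s \<in> interior (dual_cone linf_cone)"
  shows "isCont linf_maximizer s"
proof -
  have lim: "(linf_slope_root \<longlongrightarrow> linf_slope_root s) (at s)"
    using isCont_linf_slope_root[OF s] by (simp add: isCont_def)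
  have nz: "1 + sqrt (1 + a\<^sup>2 * b\<^sup>2) \<noteq> 0" for a b :: real
    using real_sqrt_ge_zero[of "1 + a\<^sup>2 * b\<^sup>2"] by (smt (verit) zero_le_mult_iff zero_le_power2)
  show ?thesis
    unfolding isCont_def linf_maximizer_def linf_inner_opt_def
    using linf_slope_root(1)[OF s] by (intro tendsto_intros lim nz) auto
qed

text \<open>Passes from the rationalised components of the maximiser to the usual form with its case distinction.\<close>

lemma rationalised_root_eq:
  fixes y a :: real
  shows "a * y\<^sup>2 / (1 + sqrt (1 + a\<^sup>2 * y\<^sup>2)) =
    (if a \<noteq> 0 then (sqrt (1 + y\<^sup>2 * a\<^sup>2) - 1) / a else 0)"
proof -
  define S where "S = sqrt (1 + a\<^sup>2 * y\<^sup>2)"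
  have "S \<ge> 1" and S2: "S\<^sup>2 = 1 + a\<^sup>2 * y\<^sup>2" by (simp_all add: S_def)
  then have nz: "1 + S \<noteq> 0" by simp
  have "a * y\<^sup>2 / (1 + S) = (S - 1) / a" if "a \<noteq> 0"
    using nz that S2 by (simp add: divide_simps) algebra
  then show ?thesis unfolding S_def by (simp add: mult.commute)
qed

theorem proposition3p6:
  fixes p :: real and r :: "real ^ 'd"
  assumes "(p, r) \<in> interior (dual_cone linf_cone)"
  shows "bdd_above ((\<lambda>w. - inner (p, r) w - linf_barrier w) ` interior linf_cone)
    \<and> (GDERIV (conjugate_barrier linf_cone linf_barrier) (p, r) :>
          conjugate_gradient linf_cone linf_barrier (p, r))
    \<and> (\<exists>!y. y < 0 \<and> linf_root_fun p r y = 0)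
    \<and> (\<forall>y. y < 0 \<and> linf_root_fun p r y = 0 \<longrightarrow>
          fst (conjugate_gradient linf_cone linf_barrier (p, r)) = y
        \<and> (\<forall>i. snd (conjugate_gradient linf_cone linf_barrier (p, r)) $ i =
              (if r $ i \<noteq> 0 then (sqrt (1 + y\<^sup>2 * (r $ i)\<^sup>2) - 1) / (r $ i) else 0)))"
proof -
  let ?g = "conjugate_gradient linf_cone linf_barrier (p, r)"
  let ?y = "- (1 / linf_slope_root (p, r))"
  note pos = linf_slope_root(1)[OF assms]
    and root = linf_slope_root(2)[OF assms, unfolded fst_conv snd_conv]
  have bdd: "bdd_above ((\<lambda>w. - inner (p, r) w - linf_barrier w) ` interior linf_cone)"
    using linf_maximizer(2)[OF assms] by (rule bdd_aboveI2)
  have D: "GDERIV (conjugate_barrier linf_cone linf_barrier) (p, r) :> - linf_maximizer (p, r)"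
    using assms linf_maximizer isCont_linf_maximizer
    by (intro GDERIV_conjugate_barrier[where U = "interior (dual_cone linf_cone)"]) auto
  have g: "?g = - linf_maximizer (p, r)"
    using D by (rule conjugate_gradient_eqI)
  have y: "y < 0 \<and> linf_root_fun p r y = 0 \<longleftrightarrow> y = ?y" for y
  proof
    assume "y < 0 \<and> linf_root_fun p r y = 0"
    then have "0 < 1 / - y \<and> linf_slope p r (1 / - y) = 0"
      using linf_root_fun_eq_slope[of "- y" p r] by simp
    then have inv_y: "1 / - y = linf_slope_root (p, r)"
      using linf_slope_root_ex1[OF mem_interior_dual_linf_coneD[OF assms]] pos root by blast
    then show "y = ?y" by (simp flip: inv_y)
  next
    assume "y = ?y"
    then show "y < 0 \<and> linf_root_fun p r y = 0"
      using linf_root_fun_eq_slope[of "1 / linf_slope_root (p, r)" p r] pos root by simp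
  qed
  have components: "fst ?g = ?y"
      "snd ?g $ i = (if r $ i \<noteq> 0 then (sqrt (1 + ?y\<^sup>2 * (r $ i)\<^sup>2) - 1) / (r $ i) else 0)" for i
    using rationalised_root_eq[of "r $ i" ?y]
    by (simp_all add: g linf_maximizer_def linf_inner_opt_def)
  have "\<exists>!y. y < 0 \<and> linf_root_fun p r y = 0"
    unfolding y by (rule ex1I[of _ ?y]) simp_all
  moreover have "fst ?g = z \<and> (\<forall>i. snd ?g $ i =
      (if r $ i \<noteq> 0 then (sqrt (1 + z\<^sup>2 * (r $ i)\<^sup>2) - 1) / (r $ i) else 0))"
    if "z < 0 \<and> linf_root_fun p r z = 0" for z
  proof -
    have z: "z = ?y" using that y by (rule iffD1[rotated])
    show ?thesis unfolding z by (intro conjI allI components)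
  qed
  ultimately show ?thesis
    using bdd D[folded g] by blast
qed

end
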